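(* Let $n\in\mathbb N$, let $Z_1,\dots,Z_n$ be independent with $Z_i\sim N(\mu_i,1)$, $\mu_i\ge0$, let $r_i=\mathbf 1(\mu_i>0)$ and $p_i=1-\Phi(Z_i)$. Let $\alpha,\beta\in(0,1)$. (a) The batch Stouffer test at level $\alpha$, which rejects iff $\sum_{i=1}^n\Phi^{-1}(1-p_i)>\sqrt n\,Z_\alpha$, has power at least $1-\beta$ if and only if $\sum_{i=1}^n r_i\mu_i\ge (Z_\alpha+Z_\beta)n^{1/2}$, where $Z_\gamma=\Phi^{-1}(1-\gamma)$. (b) The martingale Stouffer test at level $\alpha$, which rejects iff there is $k\in\{1,\dots,n\}$ with $\sum_{i=1}^k\Phi^{-1}(1-p_i)\ge C_k^\alpha k^{1/2}$, has power at least $1-\beta$ if there exists $k\in\{1,\dots,n\}$ with $\sum_{i=1}^k r_i\mu_i\ge (C_k^\alpha+C_k^\beta)k^{1/2}$. (c) If $\alpha<1-\beta$, the power of this martingale Stouffer test is less than $1-\beta$ whenever $\sum_{i=1}^k r_i\mu_i\le (C_k^\alpha-C_k^{1-\beta})k^{1/2}$ for all $k\in\{1,\dots,n\}$.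
   Context: $\Phi$ is the standard Gaussian CDF. For $\gamma\in(0,1)$ and $k\ge1$, $C_k^\gamma:=1.7\sqrt{\log\log(2k)+0.72\log\frac{5.2}{\gamma}}$, so that $C_k^\alpha k^{1/2}=1.7\sqrt{k(\log\log(2k)+0.72\log\frac{5.2}{\alpha})}$ is the curved boundary. The power of a test is the probability that it rejects. *)

theory Defs
  imports "HOL-Probability.Probability"
begin

definition Phi :: "real \<Rightarrow> real" where
  "Phi x = measure (density lborel std_normal_density) {..x}"

text \<open>Quantile function (inverse of Phi on (0,1); Phi is strictly increasing).\<close>
definition Phi_inv :: "real \<Rightarrow> real" where
  "Phi_inv y = (THE x. Phi x = y)"

definition Zq :: "real \<Rightarrow> real" where
  "Zq \<gamma> = Phi_inv (1 - \<gamma>)"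

definition Ck :: "nat \<Rightarrow> real \<Rightarrow> real" where
  "Ck k \<gamma> = 1.7 * sqrt (ln (ln (2 * real k)) + 0.72 * ln (5.2 / \<gamma>))"

end

theory Submission
  imports Defs
begin

text \<open>
  Since \<open>Phi_inv (1 - p i) = Z i\<close>, both tests look at partial sums of independent normal variables,
  so (a) is the computation of a normal tail. Parts (b) and (c) both follow from the statement that
  a centred random walk with independent standard normal steps hits the curve \<open>Ck k \<gamma> * sqrt k\<close> by
  time \<open>n\<close> with probability less than \<open>\<gamma>\<close>, applied to the walk or to its negative.

  This is shown by stitching. On the dyadic epoch \<open>2 ^ j \<le> k < 2 ^ (j + 1)\<close> the curve lies above a
  line \<open>k \<mapsto> L j / l + l * k / 2\<close>, which is hit with probability at most \<open>exp (- L j)\<close> by the maximal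
  inequality for the exponential martingale. With
  \<open>L j = 7/5 * (ln ((j + 1) * ln 2) + 0.72 * ln (5.2 / \<gamma>))\<close> these probabilities are, up to a factor,
  the terms of the series of \<open>\<zeta>(7/5)\<close>, and they add up to less than \<open>\<gamma>\<close>.
\<close>

subsection \<open>Numerical bounds\<close>

text \<open>The right-hand side is the integral of \<open>t powr (-7/5)\<close> over the unit interval centred at \<open>x\<close>.\<close>
lemma powr_minus_7_5_le:
  fixes x :: real
  assumes x: "x \<ge> 1"
  shows "x powr (-7/5) \<le> 5/2 * ((x - 1/2) powr (-2/5) - (x + 1/2) powr (-2/5))"
proof -
  define g where "g = (\<lambda>h. 5/2 * ((x - h) powr (-2/5) - (x + h) powr (-2/5)) - 2 * h * x powr (-7/5))"
  \<comment> \<open>\<open>h\<close> is the half-width of the interval. \<open>g\<close> vanishes at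
    \<open>h = 0\<close> and has nonnegative derivative: the geometric mean of the two end values is
    at least the value at the centre, and AM-GM does the rest.\<close>
  have "g 0 \<le> g (1/2)"
  proof (rule DERIV_nonneg_imp_nondecreasing[where f = g])
    fix h :: real assume h: "0 \<le> h" "h \<le> 1/2"
    define u where "u = (x - h) powr (-7/10)"
    define v where "v = (x + h) powr (-7/10)"
    have "(g has_real_derivative (x - h) powr (-7/5) + (x + h) powr (-7/5) - 2 * x powr (-7/5)) (at h)"
      unfolding g_def using x h by (auto intro!: derivative_eq_intros)
    moreover have "x powr (-7/5) \<le> u * v"
    proof -
      have "x powr (-7/5) = (x * x) powr (-7/10)"
        using x by (simp add: powr_mult flip: powr_add)
      also have "\<dots> \<le> ((x - h) * (x + h)) powr (-7/10)"
      proof (rule powr_mono2')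
        show "(x - h) * (x + h) \<le> x * x" by (simp add: algebra_simps)
        show "0 < (x - h) * (x + h)" using x h by (intro mult_pos_pos) auto
      qed simp
      also have "\<dots> = u * v"
        using x h by (simp add: powr_mult u_def v_def)
      finally show ?thesis .
    qed
    moreover have "2 * (u * v) \<le> u\<^sup>2 + v\<^sup>2"
      using sum_squares_bound[of u v] by simp
    moreover have "u\<^sup>2 = (x - h) powr (-7/5)" "v\<^sup>2 = (x + h) powr (-7/5)"
      by (simp_all add: u_def v_def power2_eq_square flip: powr_add)
    ultimately show "\<exists>y. (g has_real_derivative y) (at h) \<and> 0 \<le> y"
      by (intro exI[of _ "(x - h) powr (-7/5) + (x + h) powr (-7/5) - 2 * x powr (-7/5)"]) auto
  qed auto
  then show ?thesis by (simp add: g_def)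
qed

text \<open>The first term is kept exact; the bounds on the others telescope, starting at
  \<open>3/2\<close>.\<close>

lemma sum_powr_minus_7_5_le:
  "(\<Sum>j<n. real (Suc j) powr (-7/5)) \<le> 1 + 5/2 * (3/2) powr (-2/5)"
proof (cases n)
  case (Suc m)
  have "(\<Sum>j<m. real (Suc (Suc j)) powr (-7/5)) \<le>
      5/2 * ((3/2) powr (-2/5) - (real m + 3/2) powr (-2/5))"
  proof (induction m)
    case (Suc m)
    show ?case
      using powr_minus_7_5_le[of "real (Suc (Suc m))"] Suc
      by (simp add: algebra_simps)
  qed simp
  also have "\<dots> \<le> 5/2 * (3/2) powr (-2/5)"
    by simp
  finally show ?thesis
    unfolding Suc by (subst sum.lessThan_Suc_shift) simp
qed simp

text \<open>Turns a numerical bound on a fractional power into rational arithmetic.\<close>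

lemma powr_fifths_ge:
  fixes x y :: real
  assumes "0 < x" "0 < y" "y ^ 5 \<le> x\<^sup>2"
  shows "y \<le> x powr (2/5)"
proof -
  have "y = (y powr 5) powr (1/5)"
    using assms by (subst powr_powr) simp
  also have "\<dots> \<le> (x powr 2) powr (1/5)"
    using assms by (intro powr_mono2) (auto simp: powr_numeral)
  also have "\<dots> = x powr (2/5)"
    by (subst powr_powr) simp
  finally show ?thesis .
qed

lemma ln2_ge: "693/1000 \<le> ln (2::real)"
proof -
  have "693/1000 \<le> ln (2::real) "
    using ln_approx_bounds[of 2 3] by (auto simp: eval_nat_numeral)
  then show ?thesis by auto
qed

text \<open>The total constant in the sum of the epoch errors, where
  \<open>126/125 = 7/5 * 0.72\<close>. The rational bounds below multiply to about 0.998, so they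
  leave little slack.\<close>

lemma stitching_constant_less_1:
  "(1 + 5/2 * (3/2) powr (-2/5)) * ln 2 powr (-7/5) * (26/5) powr (-126/125) < (1::real)"
proof -
  have a: "(3/2) powr (-2/5) \<le> (851/1000 :: real)"
  proof -
    have "1000/851 \<le> (3/2 :: real) powr (2/5)"
      by (rule powr_fifths_ge) (auto simp: power_divide)
    then show ?thesis by (simp add: powr_minus field_simps)
  qed
  have b: "ln 2 powr (-7/5) \<le> 1/(693/1000 * (863/1000) :: real)"
  proof -
    have "863/1000 \<le> (693/1000 :: real) powr (2/5)"
      by (rule powr_fifths_ge) (auto simp: power_divide)
    also have "\<dots> \<le> ln 2 powr (2/5)"
      using ln2_ge by (intro powr_mono2) auto
    finally have "693/1000 * (863/1000) \<le> ln 2 * ln 2 powr (2/5 :: real)"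
      using ln2_ge by (intro mult_mono) auto
    also have "\<dots> = ln 2 powr (7/5 :: real)"
      by (subst powr_mult_base) auto
    finally show ?thesis by (simp add: powr_minus field_simps)
  qed
  have c: "(26/5) powr (-126/125) \<le> 1/(26/5 * (126/125) :: real)"
  proof -
    \<comment> \<open>Since \<open>ln (26/5)\<close> is at least 1, the surplus power
      \<open>(26/5) powr (1/125)\<close> is at least \<open>126/125\<close>.\<close>
    have "exp 1 \<le> (26/5::real)" using e_less_272 by simp
    then have "1 \<le> ln (26/5::real)" by (subst ln_ge_iff) auto
    then have "126/125 \<le> 1 + 1/125 * ln (26/5::real)" by simp
    also have "\<dots> \<le> (26/5) powr (1/125)"
      unfolding powr_def using exp_ge_add_one_self[of "1/125 * ln (26/5::real)"] by simp
    finally have "26/5 * (126/125) \<le> 26/5 * (26/5::real) powr (1/125)" by simp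
    also have "\<dots> = (26/5) powr (126/125)"
      by (subst powr_mult_base) auto
    finally show ?thesis by (simp add: powr_minus field_simps)
  qed
  have "(1 + 5/2 * (3/2) powr (-2/5)) * ln 2 powr (-7/5) * (26/5) powr (-126/125)
     \<le> (1 + 5/2 * (851/1000)) * (1/(693/1000 * (863/1000))) * (1/(26/5 * (126/125) :: real))"
    using a by (intro mult_mono b c) auto
  also have "\<dots> < 1" by simp
  finally show ?thesis .
qed

subsection \<open>The standard normal distribution function\<close>

interpretation std_normal: real_distribution std_normal_distribution
  by (simp add: real_distribution_def real_distribution_axioms_def prob_space_normal_density)

text \<open>The density is positive everywhere, so an interval of zero mass would be a Lebesgue null
  set.\<close>

lemma strict_mono_Phi: "strict_mono Phi"
proof (rule strict_monoI)
  fix x y :: real assume "x < y"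
  have "Phi y - Phi x = measure std_normal_distribution {x<..y}"
    unfolding Phi_def using std_normal.cdf_diff_eq[OF \<open>x < y\<close>] by (simp add: cdf_def)
  also have "\<dots> \<noteq> 0"
  proof
    assume "measure std_normal_distribution {x<..y} = 0"
    then have "{x<..y} \<in> null_sets std_normal_distribution"
      by (simp add: null_sets_def std_normal.emeasure_eq_measure)
    then have "AE z in lborel. z \<in> {x<..y} \<longrightarrow> std_normal_density z = 0"
      by (subst (asm) null_sets_density_iff) auto
    then have "AE z in lborel. z \<notin> {x<..y}"
      by eventually_elim (use normal_density_pos[of 1 0] in \<open>auto simp: less_le\<close>)
    then have "{x<..y} \<in> null_sets lborel"
      by (subst AE_iff_null_sets) auto
    then show False using \<open>x < y\<close> by (auto simp: null_sets_def)
  qed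
  finally have "Phi x \<noteq> Phi y" by simp
  moreover have "Phi x \<le> Phi y"
    unfolding Phi_def using \<open>x < y\<close> by (intro std_normal.finite_measure_mono) auto
  ultimately show "Phi x < Phi y" by simp
qed

text \<open>Injectivity suffices here, so the tests can be rewritten in terms of \<open>Z\<close> at
  every point, without an exceptional null set.\<close>

lemma Phi_inv_Phi [simp]: "Phi_inv (Phi x) = x"
  unfolding Phi_inv_def using strict_mono_Phi by (auto simp: strict_mono_eq)

lemma isCont_Phi: "isCont Phi x"
proof -
  have "measure std_normal_distribution {x} = 0"
    by (simp add: measure_def emeasure_density nn_integral_0_iff_AE)
  then show ?thesis
    using std_normal.isCont_cdf[of x] by (simp add: Phi_def[abs_def] cdf_def[abs_def])
qed

text \<open>The description in \<open>Phi_inv\<close> is meaningful only for attained values; the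
  limits at both infinities and the intermediate value theorem give attainment.\<close>

lemma Phi_Phi_inv:
  assumes "0 < y" "y < 1"
  shows "Phi (Phi_inv y) = y"
proof -
  have Phi_eq: "Phi = cdf std_normal_distribution"
    by (simp add: Phi_def[abs_def] cdf_def[abs_def])
  obtain a where a: "Phi a < y"
    using order_tendstoD(2)[OF std_normal.cdf_lim_at_bot \<open>0 < y\<close>]
    by (auto simp: Phi_eq eventually_at_bot_linorder)
  obtain b where b: "y < Phi b"
    using order_tendstoD(1)[OF std_normal.cdf_lim_at_top_prob \<open>y < 1\<close>]
    by (auto simp: Phi_eq eventually_at_top_linorder)
  have "a \<le> b"
    using strict_mono_less[OF strict_mono_Phi, of a b] a b by simp
  then obtain x where "Phi x = y"
    using IVT[of Phi a y b] a b isCont_Phi by fastforce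
  then show ?thesis by (metis Phi_inv_Phi)
qed

lemma Phi_Zq: "0 < \<gamma> \<Longrightarrow> \<gamma> < 1 \<Longrightarrow> Phi (Zq \<gamma>) = 1 - \<gamma>"
  by (simp add: Zq_def Phi_Phi_inv)

text \<open>The reflected variable \<open>(m - X) / s\<close> is standard normal, so an upper tail
  is directly a value of \<open>Phi\<close>.\<close>

lemma (in prob_space) prob_normal_greater:
  assumes X: "distributed M lborel X (normal_density m s)" and "s > 0"
  shows "prob {\<omega> \<in> space M. t < X \<omega>} = Phi ((m - t) / s)"
proof -
  have "distributed M lborel (\<lambda>\<omega>. m / s + (- 1 / s) * X \<omega>)
      (normal_density (m / s + (- 1 / s) * m) (\<bar>- 1 / s\<bar> * s))"
    using assms by (intro normal_density_affine) auto
  then have Y: "distributed M lborel (\<lambda>\<omega>. (m - X \<omega>) / s) std_normal_density"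
    using \<open>s > 0\<close> by (simp add: diff_divide_distrib)
  have [measurable]: "X \<in> borel_measurable M"
    using distributed_measurable[OF X] by simp
  have "Phi ((m - t) / s) = prob {\<omega> \<in> space M. (m - X \<omega>) / s \<le> (m - t) / s}"
    unfolding Phi_def distributed_distr_eq_density[OF Y, symmetric]
    by (subst measure_distr) (auto intro!: arg_cong[where f = prob])
  also have "\<dots> = prob {\<omega> \<in> space M. t \<le> X \<omega>}"
    using \<open>s > 0\<close> by (auto intro!: arg_cong[where f = prob] simp: divide_le_cancel)
  \<comment> \<open>\<open>Phi\<close> measures closed half-lines; the absence of atoms allows the
    strict inequality of the test.\<close>
  also have "\<dots> = prob {\<omega> \<in> space M. t < X \<omega>}"
  proof (rule measure_eq_AE)
    have "emeasure (distr M lborel X) {t} = 0"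
      unfolding distributed_distr_eq_density[OF X]
      by (simp add: emeasure_density nn_integral_0_iff_AE)
    then have "AE \<omega> in M. X \<omega> \<noteq> t"
      by (subst (asm) emeasure_distr) (auto intro!: AE_I[of _ _ "X -` {t} \<inter> space M"])
    then show "AE \<omega> in M. \<omega> \<in> {\<omega> \<in> space M. t \<le> X \<omega>} \<longleftrightarrow> \<omega> \<in> {\<omega> \<in> space M. t < X \<omega>}"
      by eventually_elim auto
  qed auto
  finally show ?thesis by simp
qed

subsection \<open>A maximal inequality for products\<close>

lemma (in prob_space) indep_var_nn_integral_mult:
  fixes f g :: "'b \<Rightarrow> ennreal"
  assumes ind: "indep_var N1 A N2 B"
    and f: "f \<in> borel_measurable N1" and g: "g \<in> borel_measurable N2"
  shows "(\<integral>\<^sup>+\<omega>. f (A \<omega>) * g (B \<omega>) \<partial>M) = (\<integral>\<^sup>+\<omega>. f (A \<omega>) \<partial>M) * (\<integral>\<^sup>+\<omega>. g (B \<omega>) \<partial>M)"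
proof -
  have "indep_var borel (f \<circ> A) borel (g \<circ> B)"
    by (rule indep_var_compose[OF ind f g])
  then have "indep_vars (\<lambda>_. borel) (case_bool (f \<circ> A) (g \<circ> B)) UNIV"
    unfolding indep_var_def by (rule indep_vars_cong[THEN iffD1, rotated -1]) (auto split: bool.split)
  from indep_vars_nn_integral[OF _ this] show ?thesis
    by (simp add: UNIV_bool mult.commute comp_def)
qed

text \<open>Stopping makes Markov's inequality at the final time control the maximum over all times.\<close>
fun stopped_prod :: "ennreal \<Rightarrow> (nat \<Rightarrow> ennreal) \<Rightarrow> nat \<Rightarrow> ennreal" where
  "stopped_prod c y 0 = 1"
| "stopped_prod c y (Suc k) =
     (if 1 \<le> c * stopped_prod c y k then stopped_prod c y k else stopped_prod c y k * y (Suc k))"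

lemma stopped_prod_stays:
  assumes "1 \<le> c * stopped_prod c y k" "k \<le> m"
  shows "1 \<le> c * stopped_prod c y m"
  using assms(2,1) by (induction m rule: dec_induct) auto

text \<open>Until it stops, the recursion multiplies all factors.\<close>

lemma stopped_prod_cases: "stopped_prod c y k = (\<Prod>i=1..k. y i) \<or> 1 \<le> c * stopped_prod c y k"
  by (induction k) (auto simp: mult.commute)

lemma stopped_prod_hit:
  assumes "1 \<le> c * (\<Prod>i=1..k. y i)" "k \<le> m"
  shows "1 \<le> c * stopped_prod c y m"
  using stopped_prod_cases[of c y k] stopped_prod_stays[of c y k m] assms by auto

text \<open>Stopping looks only at past factors. Hence the process at time \<open>k\<close> is a
  function of the restriction to \<open>{1..k}\<close>, which is independent of the next
  factor.\<close>

lemma stopped_prod_cong: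
  "(\<And>i. 1 \<le> i \<Longrightarrow> i \<le> k \<Longrightarrow> y i = z i) \<Longrightarrow> stopped_prod c y k = stopped_prod c z k"
  by (induction k) auto

lemma measurable_stopped_prod:
  assumes "\<And>i. 1 \<le> i \<Longrightarrow> i \<le> k \<Longrightarrow> (\<lambda>x. y x i) \<in> borel_measurable N"
  shows "(\<lambda>x. stopped_prod c (y x) k) \<in> borel_measurable N"
  using assms
proof (induction k)
  case (Suc k)
  have [measurable]: "(\<lambda>x. stopped_prod c (y x) k) \<in> borel_measurable N"
    "(\<lambda>x. y x (Suc k)) \<in> borel_measurable N"
    using Suc by auto
  show ?case by simp
qed simp

text \<open>The supermartingale property: stopped paths are frozen, and the others gain an
  independent factor of mean at most 1.\<close>

lemma (in prob_space) nn_integral_stopped_prod_le_1: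
  fixes Y :: "nat \<Rightarrow> 'a \<Rightarrow> ennreal"
  assumes ind: "indep_vars (\<lambda>_. borel) Y {1..n}"
    and le1: "\<And>i. i \<in> {1..n} \<Longrightarrow> (\<integral>\<^sup>+\<omega>. Y i \<omega> \<partial>M) \<le> 1"
    and "k \<le> n"
  shows "(\<integral>\<^sup>+\<omega>. stopped_prod c (\<lambda>i. Y i \<omega>) k \<partial>M) \<le> 1"
  using \<open>k \<le> n\<close>
proof (induction k)
  case 0 then show ?case by (simp add: emeasure_space_1)
next
  case (Suc k)
  have Y[measurable]: "Y i \<in> borel_measurable M" if "i \<in> {1..n}" for i
    using ind that unfolding indep_vars_def by auto
  let ?W = "\<lambda>\<omega>. stopped_prod c (\<lambda>i. Y i \<omega>) k"
  have [measurable]: "?W \<in> borel_measurable M"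
    using Suc.prems by (intro measurable_stopped_prod Y) auto
  have [measurable]: "Y (Suc k) \<in> borel_measurable M"
    using Suc.prems by (intro Y) auto
  \<comment> \<open>The contribution of the paths not yet stopped, as a function on the product
    space to which independence of the two restrictions applies.\<close>
  define f where "f = (\<lambda>y. stopped_prod c y k * indicator {y. \<not> 1 \<le> c * stopped_prod c y k} y)"
  have ind2: "indep_var (PiM {1..k} (\<lambda>_. borel)) (\<lambda>\<omega>. restrict (\<lambda>i. Y i \<omega>) {1..k})
      (PiM {Suc k} (\<lambda>_. borel)) (\<lambda>\<omega>. restrict (\<lambda>i. Y i \<omega>) {Suc k})"
    using Suc.prems by (intro indep_var_restrict[OF ind]) auto
  have [measurable]: "(\<lambda>y. stopped_prod c y k) \<in> borel_measurable (PiM {1..k} (\<lambda>_. borel))"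
    by (intro measurable_stopped_prod measurable_component_singleton) auto
  have f: "f \<in> borel_measurable (PiM {1..k} (\<lambda>_. borel))"
    unfolding f_def indicator_def mem_Collect_eq of_bool_def by measurable
  have f_eq: "f (restrict (\<lambda>i. Y i \<omega>) {1..k}) = ?W \<omega> * indicator {\<omega>. \<not> 1 \<le> c * ?W \<omega>} \<omega>" for \<omega>
    using stopped_prod_cong[of k "restrict (\<lambda>i. Y i \<omega>) {1..k}" "\<lambda>i. Y i \<omega>" c]
    by (auto simp: f_def indicator_def)
  have "(\<integral>\<^sup>+\<omega>. ?W \<omega> * indicator {\<omega>. \<not> 1 \<le> c * ?W \<omega>} \<omega> * Y (Suc k) \<omega> \<partial>M)
      = (\<integral>\<^sup>+\<omega>. ?W \<omega> * indicator {\<omega>. \<not> 1 \<le> c * ?W \<omega>} \<omega> \<partial>M) * (\<integral>\<^sup>+\<omega>. Y (Suc k) \<omega> \<partial>M)"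
    using indep_var_nn_integral_mult[OF ind2 f, of "\<lambda>y. y (Suc k)", unfolded f_eq] by simp
  also have "\<dots> \<le> (\<integral>\<^sup>+\<omega>. ?W \<omega> * indicator {\<omega>. \<not> 1 \<le> c * ?W \<omega>} \<omega> \<partial>M) * 1"
    using Suc.prems by (intro mult_left_mono le1) auto
  finally have *: "(\<integral>\<^sup>+\<omega>. ?W \<omega> * indicator {\<omega>. \<not> 1 \<le> c * ?W \<omega>} \<omega> * Y (Suc k) \<omega> \<partial>M)
      \<le> (\<integral>\<^sup>+\<omega>. ?W \<omega> * indicator {\<omega>. \<not> 1 \<le> c * ?W \<omega>} \<omega> \<partial>M)"
    by simp
  have "(\<integral>\<^sup>+\<omega>. stopped_prod c (\<lambda>i. Y i \<omega>) (Suc k) \<partial>M) =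
     (\<integral>\<^sup>+\<omega>. ?W \<omega> * indicator {\<omega>. 1 \<le> c * ?W \<omega>} \<omega>
        + ?W \<omega> * indicator {\<omega>. \<not> 1 \<le> c * ?W \<omega>} \<omega> * Y (Suc k) \<omega> \<partial>M)"
    by (intro nn_integral_cong) (auto simp: indicator_def)
  also have "\<dots> = (\<integral>\<^sup>+\<omega>. ?W \<omega> * indicator {\<omega>. 1 \<le> c * ?W \<omega>} \<omega> \<partial>M)
      + (\<integral>\<^sup>+\<omega>. ?W \<omega> * indicator {\<omega>. \<not> 1 \<le> c * ?W \<omega>} \<omega> * Y (Suc k) \<omega> \<partial>M)"
    unfolding indicator_def by (intro nn_integral_add) auto
  also have "\<dots> \<le> (\<integral>\<^sup>+\<omega>. ?W \<omega> * indicator {\<omega>. 1 \<le> c * ?W \<omega>} \<omega> \<partial>M)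
      + (\<integral>\<^sup>+\<omega>. ?W \<omega> * indicator {\<omega>. \<not> 1 \<le> c * ?W \<omega>} \<omega> \<partial>M)"
    using * by (intro add_left_mono)
  also have "\<dots> = (\<integral>\<^sup>+\<omega>. ?W \<omega> * indicator {\<omega>. 1 \<le> c * ?W \<omega>} \<omega>
        + ?W \<omega> * indicator {\<omega>. \<not> 1 \<le> c * ?W \<omega>} \<omega> \<partial>M)"
    unfolding indicator_def by (intro nn_integral_add[symmetric]) auto
  also have "\<dots> = (\<integral>\<^sup>+\<omega>. ?W \<omega> \<partial>M)"
    by (intro nn_integral_cong) (auto simp: indicator_def)
  also have "\<dots> \<le> 1" using Suc by simp
  finally show ?case .
qed

text \<open>Ville's inequality, with \<open>c\<close> as the reciprocal of the level: once the
  product has reached the level, the stopped product is still there at time \<open>n\<close>, where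
  Markov's inequality applies.\<close>

lemma (in prob_space) prod_maximal_inequality:
  fixes Y :: "nat \<Rightarrow> 'a \<Rightarrow> ennreal"
  assumes ind: "indep_vars (\<lambda>_. borel) Y {1..n}"
    and le1: "\<And>i. i \<in> {1..n} \<Longrightarrow> (\<integral>\<^sup>+\<omega>. Y i \<omega> \<partial>M) \<le> 1"
  shows "emeasure M {\<omega> \<in> space M. \<exists>k\<in>{1..n}. 1 \<le> c * (\<Prod>i=1..k. Y i \<omega>)} \<le> c"
proof -
  let ?W = "\<lambda>\<omega>. stopped_prod c (\<lambda>i. Y i \<omega>) n"
  have [measurable]: "?W \<in> borel_measurable M"
    using ind by (intro measurable_stopped_prod) (auto simp: indep_vars_def)
  have "emeasure M {\<omega> \<in> space M. \<exists>k\<in>{1..n}. 1 \<le> c * (\<Prod>i=1..k. Y i \<omega>)}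
      \<le> emeasure M {\<omega> \<in> space M. 1 \<le> c * ?W \<omega>}"
    by (intro emeasure_mono) (auto intro: stopped_prod_hit)
  also have "\<dots> \<le> c * (\<integral>\<^sup>+\<omega>. ?W \<omega> * indicator (space M) \<omega> \<partial>M)"
    by (rule nn_integral_Markov_inequality) auto
  also have "\<dots> = c * (\<integral>\<^sup>+\<omega>. ?W \<omega> \<partial>M)"
    by (intro arg_cong2[where f = "(*)"] nn_integral_cong) auto
  also have "\<dots> \<le> c * 1"
    using nn_integral_stopped_prod_le_1[OF ind le1 order_refl] by (intro mult_left_mono) auto
  finally show ?thesis by simp
qed

text \<open>The factors \<open>exp (l * X i - l^2 / 2)\<close> multiply to the exponential
  martingale, and crossing the line means that it reaches \<open>exp L\<close>.\<close>

lemma (in prob_space) subgaussian_line_crossing: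
  fixes X :: "nat \<Rightarrow> 'a \<Rightarrow> real"
  assumes ind: "indep_vars (\<lambda>_. borel) X {1..n}"
    and mgf: "\<And>i. i \<in> {1..n} \<Longrightarrow> (\<integral>\<^sup>+\<omega>. ennreal (exp (l * X i \<omega> - l\<^sup>2 / 2)) \<partial>M) \<le> 1"
  shows "prob {\<omega> \<in> space M. \<exists>k\<in>{1..n}. L + l\<^sup>2 * real k / 2 \<le> l * (\<Sum>i=1..k. X i \<omega>)} \<le> exp (- L)"
proof -
  define Y where "Y = (\<lambda>i \<omega>. ennreal (exp (l * X i \<omega> - l\<^sup>2 / 2)))"
  have "indep_vars (\<lambda>_. borel) Y {1..n}"
    unfolding Y_def by (rule indep_vars_compose2[OF ind]) auto
  then have "emeasure M {\<omega> \<in> space M. \<exists>k\<in>{1..n}. 1 \<le> ennreal (exp (- L)) * (\<Prod>i=1..k. Y i \<omega>)}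
      \<le> ennreal (exp (- L))"
    using mgf by (intro prod_maximal_inequality) (auto simp: Y_def)
  moreover have "1 \<le> ennreal (exp (- L)) * (\<Prod>i=1..k. Y i \<omega>)
      \<longleftrightarrow> L + l\<^sup>2 * real k / 2 \<le> l * (\<Sum>i=1..k. X i \<omega>)" for k \<omega>
  proof -
    have "ennreal (exp (- L)) * (\<Prod>i=1..k. Y i \<omega>)
        = ennreal (exp (- L + (\<Sum>i=1..k. l * X i \<omega> - l\<^sup>2 / 2)))"
      by (simp only: Y_def prod_ennreal exp_sum exp_add ennreal_mult exp_ge_zero prod_nonneg
          finite_atLeastAtMost)
    also have "(\<Sum>i=1..k. l * X i \<omega> - l\<^sup>2 / 2) = l * (\<Sum>i=1..k. X i \<omega>) - l\<^sup>2 * real k / 2"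
      by (simp add: sum_subtractf sum_distrib_left)
    finally show ?thesis by (simp add: ennreal_1[symmetric] algebra_simps del: ennreal_1)
  qed
  ultimately show ?thesis by (simp add: emeasure_eq_measure)
qed

subsection \<open>Stitching\<close>

text \<open>
  \<open>sqrt (2 * L / (sqrt 2 * m))\<close> is the slope parameter that treats both ends of the epoch equally;
  with \<open>7/5\<close> in place of \<open>sqrt 2\<close> the constant \<open>289/140 = 1.7\<^sup>2 / (7/5)\<close> is attained exactly at \<open>v = 2 * m\<close>.
\<close>
lemma line_below_curved_boundary:
  fixes L m v :: real
  assumes "0 < L" "0 < m" "m \<le> v" "v \<le> 2 * m"
  defines "l \<equiv> sqrt (10 * L / (7 * m))"
  shows "L + l\<^sup>2 * v / 2 \<le> l * sqrt (289/140 * L * v)"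
proof -
  \<comment> \<open>After squaring and cancelling \<open>(L / (7 * m))^2\<close>, right side minus
    left side is half of this product.\<close>
  have "(2 * m - v) * (50 * v - 49 * m) \<ge> 0"
    using assms by (intro mult_nonneg_nonneg) auto
  then have "(7 * m + 5 * v)\<^sup>2 \<le> 289/2 * m * v"
    by (simp add: algebra_simps power2_eq_square)
  then have "(L / (7 * m))\<^sup>2 * (7 * m + 5 * v)\<^sup>2 \<le> (L / (7 * m))\<^sup>2 * (289/2 * m * v)"
    by (intro mult_left_mono) auto
  moreover have "L + l\<^sup>2 * v / 2 = L / (7 * m) * (7 * m + 5 * v)"
    using assms by (simp add: field_simps)
  moreover have "(l * sqrt (289/140 * L * v))\<^sup>2 = (L / (7 * m))\<^sup>2 * (289/2 * m * v)"
    using assms by (simp add: power_mult_distrib field_simps power2_eq_square)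
  ultimately have "(L + l\<^sup>2 * v / 2)\<^sup>2 \<le> (l * sqrt (289/140 * L * v))\<^sup>2"
    by (simp only: power_mult_distrib[of "L / (7 * m)"])
  then show ?thesis
    by (rule power2_le_imp_le) (use assms in auto)
qed

section \<open>Levels of the epochs and their total error\<close>

text \<open>The expression under the root in \<open>Ck\<close> at the left end
  \<open>k = 2 ^ j\<close> of the epoch.\<close>

definition epoch_level :: "real \<Rightarrow> nat \<Rightarrow> real" where
  "epoch_level \<gamma> j = ln (real (Suc j) * ln 2) + 0.72 * ln (5.2 / \<gamma>)"

text \<open>For \<open>j = 0\<close> the iterated logarithm is negative, but it exceeds
  \<open>-1/2\<close>, while the other summand is at least 0.72.\<close>

lemma epoch_level_pos:
  assumes "0 < \<gamma>" "\<gamma> < 1"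
  shows "0 < epoch_level \<gamma> j"
proof -
  have "1 - 1 / (693/1000) \<le> ln (693/1000 :: real)"
    using ln_le_minus_one[of "1 / (693/1000) :: real"] by (simp add: ln_div)
  also have "\<dots> \<le> ln (real (Suc j) * ln 2)"
  proof -
    have "1 * (693/1000) \<le> real (Suc j) * ln 2"
      using ln2_ge by (intro mult_mono) auto
    then show ?thesis by (subst ln_le_cancel_iff) auto
  qed
  finally have "- 1/2 < ln (real (Suc j) * ln 2)" by simp
  moreover have "1 \<le> ln (5.2 / \<gamma>)"
  proof -
    have "exp 1 \<le> (5.2 :: real)" using e_less_272 by simp
    also have "\<dots> \<le> 5.2 / \<gamma>" using assms by (simp add: field_simps)
    finally show ?thesis using assms by (subst ln_ge_iff) auto
  qed
  ultimately show ?thesis unfolding epoch_level_def by simp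
qed

lemma Ck_ge_epoch_level:
  assumes "2 ^ j \<le> k"
  shows "1.7 * sqrt (epoch_level \<gamma> j) \<le> Ck k \<gamma>"
proof -
  have "real (Suc j) * ln 2 = ln (2 * 2 ^ j)"
    by (simp flip: power_Suc add: ln_realpow)
  also have "\<dots> \<le> ln (2 * real k)"
  proof -
    have "(2 :: real) ^ j \<le> real k" using assms by (metis of_nat_le_iff of_nat_numeral of_nat_power)
    moreover from this have "0 < real k" by (rule less_le_trans[rotated]) simp
    ultimately show ?thesis by (subst ln_le_cancel_iff) auto
  qed
  finally have "ln (real (Suc j) * ln 2) \<le> ln (ln (2 * real k))"
    by (intro ln_mono) (auto intro: mult_pos_pos less_le_trans)
  then show ?thesis
    by (simp add: Ck_def epoch_level_def)
qed

text \<open>Each error factors into a power of \<open>j + 1\<close>, numerical constants and a power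
  of \<open>\<gamma>\<close>.\<close>

lemma sum_epoch_errors_less:
  assumes "0 < \<gamma>" "\<gamma> < 1"
  shows "(\<Sum>j<n. exp (- (7/5 * epoch_level \<gamma> j))) < \<gamma>"
proof -
  have "exp (- (7/5 * epoch_level \<gamma> j)) =
      real (Suc j) powr (-7/5) * (ln 2 powr (-7/5) * (26/5) powr (-126/125) * \<gamma> powr (126/125))" for j
  proof -
    have "exp (- (7/5 * epoch_level \<gamma> j)) =
        (real (Suc j) * ln 2) powr (-7/5) * (26/5 / \<gamma>) powr (-126/125)"
    proof -
      have "0 < real (Suc j) * ln 2" by simp
      then show ?thesis
        using assms by (simp add: powr_def epoch_level_def algebra_simps del: of_nat_Suc flip: exp_add)
    qed
    also have "(26/5 / \<gamma>) powr (-126/125) = (26/5) powr (-126/125) * \<gamma> powr (126/125)"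
      using assms by (simp add: powr_divide powr_minus powr_mult divide_simps)
    finally show ?thesis by (simp add: powr_mult)
  qed
  then have "(\<Sum>j<n. exp (- (7/5 * epoch_level \<gamma> j))) =
      (\<Sum>j<n. real (Suc j) powr (-7/5)) *
        (ln 2 powr (-7/5) * (26/5) powr (-126/125) * \<gamma> powr (126/125))"
    by (simp add: sum_distrib_right)
  also have "\<dots> \<le> (1 + 5/2 * (3/2) powr (-2/5)) *
        (ln 2 powr (-7/5) * (26/5) powr (-126/125) * \<gamma> powr (126/125))"
    by (intro mult_right_mono sum_powr_minus_7_5_le) auto
  also have "\<dots> = ((1 + 5/2 * (3/2) powr (-2/5)) * ln 2 powr (-7/5) * (26/5) powr (-126/125))
      * \<gamma> powr (126/125)"
    by simp
  also have "\<dots> < 1 * \<gamma> powr (126/125)"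
    using assms by (intro mult_strict_right_mono stitching_constant_less_1) auto
  \<comment> \<open>The exponent \<open>126/125\<close> is above 1 and \<open>\<gamma>\<close> below
    1.\<close>
  also have "\<dots> \<le> \<gamma>"
    using powr_mono'[of 1 "126/125" \<gamma>] assms by simp
  finally show ?thesis .
qed

text \<open>A union bound over the epochs: hitting the curve within epoch \<open>j\<close> forces
  crossing the line of that epoch, whose slope parameter is \<open>l j\<close>.\<close>

lemma (in prob_space) subgaussian_curved_boundary:
  fixes X :: "nat \<Rightarrow> 'a \<Rightarrow> real"
  assumes ind: "indep_vars (\<lambda>_. borel) X {1..n}"
    and mgf: "\<And>i l. i \<in> {1..n} \<Longrightarrow> (\<integral>\<^sup>+\<omega>. ennreal (exp (l * X i \<omega> - l\<^sup>2 / 2)) \<partial>M) \<le> 1"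
    and \<gamma>: "0 < \<gamma>" "\<gamma> < 1"
  shows "prob {\<omega> \<in> space M. \<exists>k\<in>{1..n}. Ck k \<gamma> * sqrt (real k) \<le> (\<Sum>i=1..k. X i \<omega>)} < \<gamma>"
proof -
  define L where "L = (\<lambda>j. 7/5 * epoch_level \<gamma> j)"
  define l where "l = (\<lambda>j. sqrt (10 * L j / (7 * 2 ^ j)))"
  define E where "E = (\<lambda>j. {\<omega> \<in> space M. \<exists>k\<in>{1..n}.
    L j + (l j)\<^sup>2 * real k / 2 \<le> l j * (\<Sum>i=1..k. X i \<omega>)})"
  have L_pos: "0 < L j" for j
    unfolding L_def using epoch_level_pos[OF \<gamma>] by simp
  have [measurable]: "X i \<in> borel_measurable M" if "i \<in> {1..n}" for i
    using ind that by (auto simp: indep_vars_def)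
  have [measurable]: "(\<lambda>\<omega>. \<Sum>i=1..k. X i \<omega>) \<in> borel_measurable M" if "k \<in> {1..n}" for k
    using that by (intro borel_measurable_sum) auto
  have E_sets: "E j \<in> events" for j
    unfolding E_def by measurable
  have "{\<omega> \<in> space M. \<exists>k\<in>{1..n}. Ck k \<gamma> * sqrt (real k) \<le> (\<Sum>i=1..k. X i \<omega>)} \<subseteq> (\<Union>j<n. E j)"
  proof clarify
    fix \<omega> k assume \<omega>: "\<omega> \<in> space M" and k: "k \<in> {1..n}"
      and hit: "Ck k \<gamma> * sqrt (real k) \<le> (\<Sum>i=1..k. X i \<omega>)"
    obtain j where j: "2 ^ j \<le> k" "k < 2 ^ (j + 1)"
      using ex_power_ivl1[of 2 k] k by auto
    \<comment> \<open>Crude, but it shows that \<open>n\<close> epochs cover all times up to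
      \<open>n\<close>.\<close>
    have "j < 2 ^ j" by (rule less_exp)
    also note j(1)
    also have "k \<le> n" using k by simp
    finally have "j < n" .
    have j': "2 ^ j \<le> real k" "real k \<le> 2 * 2 ^ j"
      using of_nat_mono[OF j(1), where 'a = real] of_nat_mono[OF less_imp_le[OF j(2)], where 'a = real]
      by simp_all
    have "L j + (l j)\<^sup>2 * real k / 2 \<le> l j * sqrt (289/140 * L j * real k)"
      unfolding l_def by (rule line_below_curved_boundary) (use L_pos j' in auto)
    \<comment> \<open>The factor \<open>7/5\<close> in \<open>L\<close> cancels:
      \<open>289/140 * 7/5 = 1.7^2\<close>.\<close>
    also have "sqrt (289/140 * L j * real k) = 1.7 * sqrt (epoch_level \<gamma> j) * sqrt (real k)"
    proof -
      have "289/140 * L j * real k = 1.7\<^sup>2 * (epoch_level \<gamma> j * real k)"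
        by (simp add: L_def power2_eq_square)
      then show ?thesis by (simp only: real_sqrt_mult real_sqrt_abs)
    qed
    also have "\<dots> \<le> Ck k \<gamma> * sqrt (real k)"
      by (intro mult_right_mono Ck_ge_epoch_level j) auto
    also have "\<dots> \<le> (\<Sum>i=1..k. X i \<omega>)" by (rule hit)
    finally have "L j + (l j)\<^sup>2 * real k / 2 \<le> l j * (\<Sum>i=1..k. X i \<omega>)"
      using L_pos[of j] by (simp add: l_def mult_left_mono)
    then have "\<omega> \<in> E j"
      unfolding E_def using \<omega> k by blast
    then show "\<omega> \<in> (\<Union>j<n. E j)"
      using \<open>j < n\<close> by blast
  qed
  then have "prob {\<omega> \<in> space M. \<exists>k\<in>{1..n}. Ck k \<gamma> * sqrt (real k) \<le> (\<Sum>i=1..k. X i \<omega>)}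
      \<le> prob (\<Union>j<n. E j)"
    using E_sets by (intro finite_measure_mono) auto
  also have "\<dots> \<le> (\<Sum>j<n. prob (E j))"
    using E_sets by (intro finite_measure_subadditive_finite) auto
  also have "\<dots> \<le> (\<Sum>j<n. exp (- L j))"
    unfolding E_def by (intro sum_mono subgaussian_line_crossing ind mgf)
  also have "\<dots> < \<gamma>"
    unfolding L_def by (rule sum_epoch_errors_less[OF \<gamma>])
  finally show ?thesis .
qed

section \<open>Normal increments and the power of the two tests\<close>

text \<open>Exponential tilting: completing the square turns the integrand into the normal density
  with mean \<open>m + l\<close>.\<close>

lemma (in prob_space) normal_mgf:
  assumes X: "distributed M lborel X (normal_density m 1)"
  shows "(\<integral>\<^sup>+\<omega>. ennreal (exp (l * (X \<omega> - m) - l\<^sup>2 / 2)) \<partial>M) = 1"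
proof -
  have "(\<integral>\<^sup>+\<omega>. ennreal (exp (l * (X \<omega> - m) - l\<^sup>2 / 2)) \<partial>M) =
      (\<integral>\<^sup>+x. ennreal (normal_density m 1 x) * ennreal (exp (l * (x - m) - l\<^sup>2 / 2)) \<partial>lborel)"
    by (rule distributed_nn_integral[OF X, symmetric]) auto
  also have "\<dots> = (\<integral>\<^sup>+x. ennreal (normal_density (m + l) 1 x) \<partial>lborel)"
  proof (rule nn_integral_cong)
    fix x :: real
    have "- (x - m)\<^sup>2 / 2 + (l * (x - m) - l\<^sup>2 / 2) = - (x - (m + l))\<^sup>2 / 2"
      by (simp add: power2_eq_square field_simps)
    then have "normal_density m 1 x * exp (l * (x - m) - l\<^sup>2 / 2) = normal_density (m + l) 1 x"
      by (simp add: normal_density_def flip: exp_add)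
    then show "ennreal (normal_density m 1 x) * ennreal (exp (l * (x - m) - l\<^sup>2 / 2))
        = ennreal (normal_density (m + l) 1 x)"
      by (simp flip: ennreal_mult)
  qed
  also have "\<dots> = 1"
    by (subst nn_integral_eq_integral) auto
  finally show ?thesis .
qed

theorem theorem4:
  fixes M :: "'a measure" and Z :: "nat \<Rightarrow> 'a \<Rightarrow> real"
    and \<mu> :: "nat \<Rightarrow> real" and n :: nat and \<alpha> \<beta> :: real
  assumes "prob_space M"
    and "n \<ge> 1"
    and "prob_space.indep_vars M (\<lambda>_. borel) Z {1..n}"
    and "\<And>i. i \<in> {1..n} \<Longrightarrow> distributed M lborel (Z i) (normal_density (\<mu> i) 1)"
    and "\<And>i. i \<in> {1..n} \<Longrightarrow> \<mu> i \<ge> 0"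
    and "0 < \<alpha>" "\<alpha> < 1" "0 < \<beta>" "\<beta> < 1"
  defines "r \<equiv> (\<lambda>i. if \<mu> i > 0 then 1 else (0::real))"
    and "p \<equiv> (\<lambda>i \<omega>. 1 - Phi (Z i \<omega>))"
  shows
    "(measure M {\<omega> \<in> space M.
         (\<Sum>i=1..n. Phi_inv (1 - p i \<omega>)) > sqrt (real n) * Zq \<alpha>} \<ge> 1 - \<beta>
       \<longleftrightarrow> (\<Sum>i=1..n. r i * \<mu> i) \<ge> (Zq \<alpha> + Zq \<beta>) * sqrt (real n))
     \<and> ((\<exists>k\<in>{1..n}. (\<Sum>i=1..k. r i * \<mu> i) \<ge> (Ck k \<alpha> + Ck k \<beta>) * sqrt (real k))
        \<longrightarrow> measure M {\<omega> \<in> space M. \<exists>k\<in>{1..n}.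
               (\<Sum>i=1..k. Phi_inv (1 - p i \<omega>)) \<ge> Ck k \<alpha> * sqrt (real k)} \<ge> 1 - \<beta>)
     \<and> ((\<alpha> < 1 - \<beta> \<and>
         (\<forall>k\<in>{1..n}. (\<Sum>i=1..k. r i * \<mu> i) \<le> (Ck k \<alpha> - Ck k (1 - \<beta>)) * sqrt (real k)))
        \<longrightarrow> measure M {\<omega> \<in> space M. \<exists>k\<in>{1..n}.
               (\<Sum>i=1..k. Phi_inv (1 - p i \<omega>)) \<ge> Ck k \<alpha> * sqrt (real k)} < 1 - \<beta>)"
proof -
  interpret prob_space M by fact
  have Z: "distributed M lborel (Z i) (normal_density (\<mu> i) 1)" if "i \<in> {1..n}" for i
    using assms(4) that by blast
  have [measurable]: "Z i \<in> borel_measurable M" if "i \<in> {1..n}" for i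
    using distributed_measurable[OF Z[OF that]] by simp
  have [measurable]: "(\<lambda>\<omega>. \<Sum>i=1..k. Z i \<omega>) \<in> borel_measurable M" if "k \<in> {1..n}" for k
    using that by (intro borel_measurable_sum) auto
  have r_eq: "(\<Sum>i=1..k. r i * \<mu> i) = (\<Sum>i=1..k. \<mu> i)" if "k \<in> {1..n}" for k
    using that assms(5) by (intro sum.cong) (auto simp: r_def less_le)
  have p_eq: "Phi_inv (1 - p i \<omega>) = Z i \<omega>" for i \<omega>
    by (simp add: p_def)
  have n_mem: "n \<in> {1..n}" using assms(2) by simp
  have sqrt_n: "0 < sqrt (real n)" using assms(2) by simp
  \<comment> \<open>The sign \<open>s\<close> lets one crossing bound serve both (b), with
    \<open>s = -1\<close>, and (c), with \<open>s = 1\<close>.\<close>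
  have ind: "indep_vars (\<lambda>_. borel) (\<lambda>i \<omega>. s * (Z i \<omega> - \<mu> i)) {1..n}" for s
    by (rule indep_vars_compose2[OF assms(3)]) auto
  have mgf: "(\<integral>\<^sup>+\<omega>. ennreal (exp (l * (s * (Z i \<omega> - \<mu> i)) - l\<^sup>2 / 2)) \<partial>M) \<le> 1"
    if "i \<in> {1..n}" "s\<^sup>2 = 1" for i l s
    using normal_mgf[OF Z[OF that(1)], of "l * s"] that(2) by (simp add: power_mult_distrib mult.assoc)
  have crossing: "prob {\<omega> \<in> space M. \<exists>k\<in>{1..n}.
      Ck k \<gamma> * sqrt (real k) \<le> (\<Sum>i=1..k. s * (Z i \<omega> - \<mu> i))} < \<gamma>"
    if "0 < \<gamma>" "\<gamma> < 1" "s\<^sup>2 = 1" for \<gamma> s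
    using that mgf by (intro subgaussian_curved_boundary ind)
  have a: "1 - \<beta> \<le> prob {\<omega> \<in> space M. sqrt (real n) * Zq \<alpha> < (\<Sum>i=1..n. Z i \<omega>)}
      \<longleftrightarrow> (Zq \<alpha> + Zq \<beta>) * sqrt (real n) \<le> (\<Sum>i=1..n. \<mu> i)"
  proof -
    have "distributed M lborel (\<lambda>\<omega>. \<Sum>i=1..n. Z i \<omega>)
        (normal_density (\<Sum>i=1..n. \<mu> i) (sqrt (\<Sum>i=1..n. 1\<^sup>2)))"
      using n_mem by (intro sum_indep_normal assms(3) Z) auto
    then have "distributed M lborel (\<lambda>\<omega>. \<Sum>i=1..n. Z i \<omega>)
        (normal_density (\<Sum>i=1..n. \<mu> i) (sqrt (real n)))"
      by simp
    \<comment> \<open>Writing \<open>1 - \<beta>\<close> as \<open>Phi (Zq \<beta>)\<close> reduces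
      the comparison of probabilities to one of arguments.\<close>
    from prob_normal_greater[OF this sqrt_n]
    have "1 - \<beta> \<le> prob {\<omega> \<in> space M. sqrt (real n) * Zq \<alpha> < (\<Sum>i=1..n. Z i \<omega>)}
      \<longleftrightarrow> Phi (Zq \<beta>) \<le> Phi (((\<Sum>i=1..n. \<mu> i) - sqrt (real n) * Zq \<alpha>) / sqrt (real n))"
      using assms by (simp add: Phi_Zq)
    also have "\<dots> \<longleftrightarrow> Zq \<beta> \<le> ((\<Sum>i=1..n. \<mu> i) - sqrt (real n) * Zq \<alpha>) / sqrt (real n)"
      by (rule strict_mono_less_eq[OF strict_mono_Phi])
    also have "\<dots> \<longleftrightarrow> (Zq \<alpha> + Zq \<beta>) * sqrt (real n) \<le> (\<Sum>i=1..n. \<mu> i)"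
      using sqrt_n by (simp add: pos_le_divide_eq algebra_simps)
    finally show ?thesis .
  qed
  let ?power = "prob {\<omega> \<in> space M. \<exists>k\<in>{1..n}. Ck k \<alpha> * sqrt (real k) \<le> (\<Sum>i=1..k. Z i \<omega>)}"
  have b: "1 - \<beta> \<le> ?power"
    if k: "k \<in> {1..n}" "(Ck k \<alpha> + Ck k \<beta>) * sqrt (real k) \<le> (\<Sum>i=1..k. \<mu> i)" for k
  proof -
    let ?B = "{\<omega> \<in> space M. \<exists>k\<in>{1..n}.
      Ck k \<beta> * sqrt (real k) \<le> (\<Sum>i=1..k. - 1 * (Z i \<omega> - \<mu> i))}"
    \<comment> \<open>Outside \<open>?B\<close> the noise at the given \<open>k\<close> stays above
      \<open>- Ck k \<beta> * sqrt k\<close>, so the drift carries the sum over the rejection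
      boundary.\<close>
    have "1 - \<beta> \<le> 1 - prob ?B"
      using crossing[of \<beta> "- 1"] assms by simp
    also have "\<dots> = prob (space M - ?B)"
      by (rule prob_compl[symmetric]) (simp add: sum_subtractf)
    also have "\<dots> \<le> ?power"
    proof (rule finite_measure_mono)
      show "space M - ?B \<subseteq> {\<omega> \<in> space M. \<exists>k\<in>{1..n}. Ck k \<alpha> * sqrt (real k) \<le> (\<Sum>i=1..k. Z i \<omega>)}"
      proof
        fix \<omega>
        assume *: "\<omega> \<in> space M - ?B"
        then have "(\<Sum>i=1..k. - 1 * (Z i \<omega> - \<mu> i)) < Ck k \<beta> * sqrt (real k)"
          using k(1) by (auto simp: not_le)
        also have "(\<Sum>i=1..k. - 1 * (Z i \<omega> - \<mu> i)) = (\<Sum>i=1..k. \<mu> i) - (\<Sum>i=1..k. Z i \<omega>)"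
          by (simp add: sum_subtractf)
        finally have "Ck k \<alpha> * sqrt (real k) \<le> (\<Sum>i=1..k. Z i \<omega>)"
          using k(2) by (simp add: distrib_right)
        then show "\<omega> \<in> {\<omega> \<in> space M. \<exists>k\<in>{1..n}. Ck k \<alpha> * sqrt (real k) \<le> (\<Sum>i=1..k. Z i \<omega>)}"
          using k(1) * by blast
      qed
    qed measurable
    finally show ?thesis .
  qed
  have c: "?power < 1 - \<beta>"
    if k: "\<forall>k\<in>{1..n}. (\<Sum>i=1..k. \<mu> i) \<le> (Ck k \<alpha> - Ck k (1 - \<beta>)) * sqrt (real k)"
  proof -
    let ?C = "{\<omega> \<in> space M. \<exists>k\<in>{1..n}.
      Ck k (1 - \<beta>) * sqrt (real k) \<le> (\<Sum>i=1..k. 1 * (Z i \<omega> - \<mu> i))}"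
    \<comment> \<open>Subtracting the drift bound from the rejection boundary leaves the curve of
      level \<open>1 - \<beta>\<close> for the centred walk.\<close>
    have "?power \<le> prob ?C"
    proof (rule finite_measure_mono)
      show "{\<omega> \<in> space M. \<exists>k\<in>{1..n}. Ck k \<alpha> * sqrt (real k) \<le> (\<Sum>i=1..k. Z i \<omega>)} \<subseteq> ?C"
      proof clarify
        fix \<omega> k
        assume *: "k \<in> {1..n}" "Ck k \<alpha> * sqrt (real k) \<le> (\<Sum>i=1..k. Z i \<omega>)"
        then have "(\<Sum>i=1..k. \<mu> i) \<le> (Ck k \<alpha> - Ck k (1 - \<beta>)) * sqrt (real k)"
          using k by blast
        with * show "\<exists>k\<in>{1..n}. Ck k (1 - \<beta>) * sqrt (real k) \<le> (\<Sum>i=1..k. 1 * (Z i \<omega> - \<mu> i))"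
          by (intro bexI[of _ k]) (simp_all add: sum_subtractf algebra_simps)
      qed
    qed (simp add: sum_subtractf)
    also have "\<dots> < 1 - \<beta>"
      using crossing[of "1 - \<beta>" 1] assms by simp
    finally show ?thesis .
  qed
  have r_ex: "(\<exists>k\<in>{1..n}. (Ck k \<alpha> + Ck k \<beta>) * sqrt (real k) \<le> (\<Sum>i=1..k. r i * \<mu> i))
      \<longleftrightarrow> (\<exists>k\<in>{1..n}. (Ck k \<alpha> + Ck k \<beta>) * sqrt (real k) \<le> (\<Sum>i=1..k. \<mu> i))"
    by (intro bex_cong refl) (simp only: r_eq)
  have r_all: "(\<forall>k\<in>{1..n}. (\<Sum>i=1..k. r i * \<mu> i) \<le> (Ck k \<alpha> - Ck k (1 - \<beta>)) * sqrt (real k))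
      \<longleftrightarrow> (\<forall>k\<in>{1..n}. (\<Sum>i=1..k. \<mu> i) \<le> (Ck k \<alpha> - Ck k (1 - \<beta>)) * sqrt (real k))"
    by (intro ball_cong refl) (simp only: r_eq)
  show ?thesis
    unfolding p_eq r_eq[OF n_mem] r_ex r_all using a b c by blast
qed

end
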